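(* Let $n\ge 2$. The following hold, with all shuffles taken to be of one fixed type (either all HV-shuffles or all VH-shuffles). (1) Every permutation of colored cells of an equi-$n$-square can be implemented with a composition of shuffles: for every equi-$n$-square $P$ and every permutation $\pi$ of the positions, there is a composition $\sigma$ of finitely many shuffles such that $\sigma_*P=\pi_*P$. (2) For each equi-$n$-square there exists a second one which is at least $\dfrac{\log_2(s_n)}{2n\cdot\log_2(n)}$ shuffles away, where $s_n$ denotes the number of equi-$n$-squares. (3) If moreover $2\le n\le 34$ or $n=37$, then every two equi-$n$-squares are at most $6n-3$ shuffles away if $n$ is even, and at most $6n+3$ shuffles away if $n$ is odd.
   Context: The formal $n$-square is the set of $n^2$ positions $(k,r)$ with $0\le k,r<n$; $k$ is the column number and $r$ the row number. An equi-$n$-square is a function $P$ assigning to each position a digit (color) in $\{0,\dots,n-1\}$ such that each digit is assigned to exactly $n$ positions. For a permutation $\pi$ of the positions, $\pi_*P$ is the equi-$n$-square with $(\pi_*P)(\pi(p))=P(p)$ for all positions $p$. An H-move independently rotates each row: $(k,r)\mapsto (k+a_r \bmod n,\ r)$ for some integers $a_0,\dots,a_{n-1}$. A V-move independently rotates each column: $(k,r)\mapsto(k,\ r+b_k \bmod n)$ for some integers $b_0,\dots,b_{n-1}$. A VH-shuffle is a V-move followed by an H-move; an HV-shuffle is an H-move followed by a V-move. For equi-$n$-squares $P,Q$: $Q$ is at most $m$ shuffles away from $P$ if there is a composition $\sigma$ of at most $m$ shuffles with $\sigma_*P=Q$; $Q$ is at least $x$ shuffles away from $P$ if every composition $\sigma$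 of $k$ shuffles with $\sigma_*P=Q$ has $k\ge x$. *)

theory Defs
  imports Complex_Main "HOL-Library.FuncSet" "HOL-Combinatorics.Permutations"
begin

(* A position is a pair (k, r): column number first, row number second. *)
definition positions :: "nat \<Rightarrow> (nat \<times> nat) set" where
  "positions n = {0..<n} \<times> {0..<n}"

(* Squares are extensional functions, so that equality and cardinality of sets of
   squares only depend on the values on positions n. *)
definition equi_squares :: "nat \<Rightarrow> (nat \<times> nat \<Rightarrow> nat) set" where
  "equi_squares n = {P \<in> positions n \<rightarrow>\<^sub>E {0..<n}.
     \<forall>c\<in>{0..<n}. card {p \<in> positions n. P p = c} = n}"

(* Used only for pi permuting positions n; see push_apply and push_equi_squares. *)
definition push :: "(nat \<times> nat \<Rightarrow> nat \<times> nat) \<Rightarrow> (nat \<times> nat \<Rightarrow> nat) \<Rightarrow> (nat \<times> nat \<Rightarrow> nat)" where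
  "push \<pi> P = P \<circ> inv \<pi>"

(* Moves are the identity outside positions n, in accordance with permutes. *)
definition H_move :: "nat \<Rightarrow> (nat \<Rightarrow> int) \<Rightarrow> nat \<times> nat \<Rightarrow> nat \<times> nat" where
  "H_move n a = (\<lambda>(k, r).
     if (k, r) \<in> positions n then (nat ((int k + a r) mod int n), r) else (k, r))"

definition V_move :: "nat \<Rightarrow> (nat \<Rightarrow> int) \<Rightarrow> nat \<times> nat \<Rightarrow> nat \<times> nat" where
  "V_move n b = (\<lambda>(k, r).
     if (k, r) \<in> positions n then (k, nat ((int r + b k) mod int n)) else (k, r))"

definition VH_shuffles :: "nat \<Rightarrow> (nat \<times> nat \<Rightarrow> nat \<times> nat) set" where
  "VH_shuffles n = {H_move n a \<circ> V_move n b | a b. True}"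

definition HV_shuffles :: "nat \<Rightarrow> (nat \<times> nat \<Rightarrow> nat \<times> nat) set" where
  "HV_shuffles n = {V_move n b \<circ> H_move n a | a b. True}"

fun compositions :: "('a \<Rightarrow> 'a) set \<Rightarrow> nat \<Rightarrow> ('a \<Rightarrow> 'a) set" where
  "compositions S 0 = {id}"
| "compositions S (Suc m) = {\<sigma> \<circ> \<tau> | \<sigma> \<tau>. \<sigma> \<in> S \<and> \<tau> \<in> compositions S m}"

definition at_most_away ::
  "(nat \<times> nat \<Rightarrow> nat \<times> nat) set \<Rightarrow> nat \<Rightarrow> (nat \<times> nat \<Rightarrow> nat) \<Rightarrow> (nat \<times> nat \<Rightarrow> nat) \<Rightarrow> bool" where
  "at_most_away S m P Q \<longleftrightarrow> (\<exists>k\<le>m. \<exists>\<sigma>\<in>compositions S k. push \<sigma> P = Q)"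

definition at_least_away ::
  "(nat \<times> nat \<Rightarrow> nat \<times> nat) set \<Rightarrow> real \<Rightarrow> (nat \<times> nat \<Rightarrow> nat) \<Rightarrow> (nat \<times> nat \<Rightarrow> nat) \<Rightarrow> bool" where
  "at_least_away S x P Q \<longleftrightarrow>
     (\<forall>k. \<forall>\<sigma>\<in>compositions S k. push \<sigma> P = Q \<longrightarrow> x \<le> real k)"

lemma finite_positions: "finite (positions n)"
  by (simp add: positions_def)

lemma push_apply: "\<pi> permutes positions n \<Longrightarrow> push \<pi> P (\<pi> p) = P p"
  by (simp add: push_def permutes_inverses)

lemma push_equi_squares:
  assumes \<pi>: "\<pi> permutes positions n" and P: "P \<in> equi_squares n"
  shows "push \<pi> P \<in> equi_squares n"
proof -
  have inv: "inv \<pi> permutes positions n"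
    using \<pi> by (rule permutes_inv)
  have "{p \<in> positions n. push \<pi> P p = c} = \<pi> ` {p \<in> positions n. P p = c}" for c
  proof (intro set_eqI iffI)
    fix q assume "q \<in> {p \<in> positions n. push \<pi> P p = c}"
    then have "inv \<pi> q \<in> {p \<in> positions n. P p = c}"
      using permutes_in_image[OF inv] by (simp add: push_def)
    then show "q \<in> \<pi> ` {p \<in> positions n. P p = c}"
      using permutes_inverses(1)[OF \<pi>, of q] by (metis imageI)
  next
    fix q assume "q \<in> \<pi> ` {p \<in> positions n. P p = c}"
    then show "q \<in> {p \<in> positions n. push \<pi> P p = c}"
      using permutes_in_image[OF \<pi>] push_apply[OF \<pi>] by auto
  qed
  then have "card {p \<in> positions n. push \<pi> P p = c} = card {p \<in> positions n. P p = c}" for c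
    using permutes_inj[OF \<pi>] by (simp add: card_image inj_on_def)
  moreover have "push \<pi> P \<in> positions n \<rightarrow>\<^sub>E {0..<n}"
  proof (rule PiE_I)
    fix q assume "q \<in> positions n"
    then have "inv \<pi> q \<in> positions n" using permutes_in_image[OF inv] by simp
    then show "push \<pi> P q \<in> {0..<n}"
      using P PiE_mem unfolding equi_squares_def push_def by fastforce
  next
    fix q assume q: "q \<notin> positions n"
    then have "inv \<pi> q = q" using inv by (simp add: permutes_not_in)
    then show "push \<pi> P q = undefined"
      using P q PiE_arb unfolding equi_squares_def push_def by fastforce
  qed
  ultimately show ?thesis
    using P by (simp add: equi_squares_def)
qed

lemma H_move_permutes: "H_move n a permutes positions n"
proof (rule bij_imp_permutes)
  have "H_move n (\<lambda>r. - b r) (H_move n b p) = p" for b p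
    by (cases p) (auto simp: H_move_def positions_def mod_simps nat_less_iff)
  from this[of a] this[of "\<lambda>r. - a r"]
  show "bij_betw (H_move n a) (positions n) (positions n)"
    by (intro bij_betw_byWitness[where f' = "H_move n (\<lambda>r. - a r)"])
       (auto simp: H_move_def positions_def nat_less_iff)
qed (auto simp: H_move_def)

lemma V_move_permutes: "V_move n b permutes positions n"
proof (rule bij_imp_permutes)
  have "V_move n (\<lambda>r. - a r) (V_move n a p) = p" for a p
    by (cases p) (auto simp: V_move_def positions_def mod_simps nat_less_iff)
  from this[of b] this[of "\<lambda>r. - b r"]
  show "bij_betw (V_move n b) (positions n) (positions n)"
    by (intro bij_betw_byWitness[where f' = "V_move n (\<lambda>r. - b r)"])
       (auto simp: V_move_def positions_def nat_less_iff)
qed (auto simp: V_move_def)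

lemma compositions_permutes:
  assumes "S = HV_shuffles n \<or> S = VH_shuffles n" "\<sigma> \<in> compositions S m"
  shows "\<sigma> permutes positions n"
proof -
  have "\<tau> permutes positions n" if "\<tau> \<in> S" for \<tau>
    using that assms(1)
    by (auto simp: HV_shuffles_def VH_shuffles_def
             intro: permutes_compose H_move_permutes V_move_permutes)
  with assms(2) show ?thesis
    by (induction m arbitrary: \<sigma>) (auto intro: permutes_id permutes_compose)
qed

end

theory Submission
  imports Defs
begin

text \<open>
  If every column contains each of n labels exactly once, then n shuffles bring every cell with
  label c to column c, by using row 0 as a conveyor belt. Given an equi-square, Koenig's edge
  colouring theorem for the regular bipartite multigraph of columns against colours labels the
  cells such that each column contains each label once and the cells of a common label have
  distinct colours. Conveying along these labels yields a square whose columns each contain every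
  colour once; conveying along the colours then yields the square whose column k has colour k.
  So every equi-square is 2n VH-shuffles away from this one square. Reversing the route of a
  second square gives 2n HV-shuffles, which regroup into 2n + 1 VH-shuffles; hence any two
  equi-squares are at most 4n + 1 shuffles apart. The lower bound compares the number of
  equi-squares with the at most n^(2n) shuffles.
\<close>

section \<open>Matchings and edge colourings of regular bipartite multigraphs\<close>

text \<open>Halmos-Vaughan induction on \<open>card I\<close>: either every nonempty proper
  subfamily has a surplus, and one index can be assigned freely, or some critical \<open>J\<close>
  attains equality in Hall's condition, and the family splits into \<open>J\<close> and its
  complement.\<close>

lemma hall_marriage:
  assumes "finite I" and "\<forall>i\<in>I. finite (A i)"
    and "\<forall>J\<subseteq>I. card J \<le> card (\<Union>(A ` J))"
  shows "\<exists>f. inj_on f I \<and> (\<forall>i\<in>I. f i \<in> A i)"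
  using assms
proof (induction "card I" arbitrary: I A rule: less_induct)
  case less
  note fin = \<open>finite I\<close> \<open>\<forall>i\<in>I. finite (A i)\<close>
    and hall = \<open>\<forall>J\<subseteq>I. card J \<le> card (\<Union>(A ` J))\<close>
  have fin_Union: "finite (\<Union>(A ` J))" if "J \<subseteq> I" for J
    using that fin by (meson finite_UN_I finite_subset subset_iff)
  consider "I = {}"
    | "I \<noteq> {}" "\<forall>J. J \<subset> I \<and> J \<noteq> {} \<longrightarrow> card J < card (\<Union>(A ` J))"
    | J where "J \<subset> I" "J \<noteq> {}" "card J = card (\<Union>(A ` J))"
    using hall by (metis le_neq_implies_less psubset_imp_subset)
  then show ?case
  proof cases
    case 1
    then show ?thesis by simp
  next
    case 2
    then obtain i where i: "i \<in> I" by blast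
    have "card {i} \<le> card (\<Union>(A ` {i}))" using hall i by blast
    then obtain x where x: "x \<in> A i" by fastforce
    \<comment> \<open>Each nonempty subfamily of \<open>I'\<close> is proper in \<open>I\<close>, so
      its union exceeds it by at least one element, which pays for the deleted
      \<open>x\<close>.\<close>
    define I' where "I' = I - {i}"
    have "\<exists>f. inj_on f I' \<and> (\<forall>j\<in>I'. f j \<in> A j - {x})"
    proof (rule less.hyps)
      show "card I' < card I"
        unfolding I'_def by (rule card_Diff1_less[OF fin(1) i])
      show "\<forall>J\<subseteq>I'. card J \<le> card (\<Union>j\<in>J. A j - {x})"
      proof (intro allI impI)
        fix J assume J: "J \<subseteq> I'"
        show "card J \<le> card (\<Union>j\<in>J. A j - {x})"
        proof (cases "J = {}")
          case False
          have "J \<subset> I" using J i by (auto simp: I'_def)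
          with False 2 have "card J < card (\<Union>(A ` J))" by blast
          moreover have "(\<Union>j\<in>J. A j - {x}) = \<Union>(A ` J) - {x}" by blast
          moreover have "card (\<Union>(A ` J)) - 1 \<le> card (\<Union>(A ` J) - {x})"
            using diff_card_le_card_Diff[of "{x}" "\<Union>(A ` J)"] by simp
          ultimately show ?thesis by simp
        qed simp
      qed
    qed (use fin in \<open>auto simp: I'_def\<close>)
    then obtain f where f: "inj_on f I'" "\<forall>j\<in>I'. f j \<in> A j - {x}" by blast
    have "inj_on (f(i := x)) I \<and> (\<forall>j\<in>I. (f(i := x)) j \<in> A j)"
      using f x i unfolding I'_def inj_on_def by auto
    then show ?thesis by blast
  next
    case 3
    define U where "U = \<Union>(A ` J)"
    have finJ: "finite J" "finite U"
      using 3 fin fin_Union finite_subset unfolding U_def by blast+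
    have "\<exists>f. inj_on f J \<and> (\<forall>j\<in>J. f j \<in> A j)"
      using 3 fin hall finJ by (intro less.hyps psubset_card_mono) auto
    then obtain f where f: "inj_on f J" "\<forall>j\<in>J. f j \<in> A j" by blast
    \<comment> \<open>Values in \<open>U\<close> are forbidden outside \<open>J\<close>. Hall's
      condition survives: \<open>J \<union> K\<close> has at least \<open>card J + card K\<close>
      values available, and \<open>U\<close> supplies only \<open>card J\<close> of them.\<close>
    have "\<exists>g. inj_on g (I - J) \<and> (\<forall>j\<in>I - J. g j \<in> A j - U)"
    proof (rule less.hyps)
      show "card (I - J) < card I"
        using fin 3 by (intro psubset_card_mono) auto
      show "\<forall>K\<subseteq>I - J. card K \<le> card (\<Union>j\<in>K. A j - U)"
      proof (intro allI impI)
        fix K assume K: "K \<subseteq> I - J"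
        have finK: "finite K" using K fin finite_subset by blast
        have "card J + card K = card (J \<union> K)"
          using K finJ finK by (subst card_Un_disjoint) auto
        also have "\<dots> \<le> card (\<Union>(A ` (J \<union> K)))"
          using K 3 hall by (metis Diff_subset Un_least order_trans psubset_imp_subset)
        also have "\<Union>(A ` (J \<union> K)) = U \<union> (\<Union>j\<in>K. A j - U)"
          by (auto simp: U_def)
        also have "card \<dots> \<le> card U + card (\<Union>j\<in>K. A j - U)"
          by (rule card_Un_le)
        finally show "card K \<le> card (\<Union>j\<in>K. A j - U)"
          using 3 by (simp add: U_def)
      qed
    qed (use fin in auto)
    then obtain g where g: "inj_on g (I - J)" "\<forall>j\<in>I - J. g j \<in> A j - U" by blast
    define h where "h j = (if j \<in> J then f j else g j)" for j
    have "inj_on h (J \<union> (I - J))"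
      unfolding inj_on_Un
    proof (intro conjI)
      show "inj_on h J" "inj_on h (I - J)"
        using f g by (auto simp: h_def inj_on_def)
      show "h ` (J - (I - J)) \<inter> h ` (I - J - J) = {}"
        using f g by (auto simp: h_def U_def)
    qed
    moreover have "J \<union> (I - J) = I" using 3 by blast
    moreover have "\<forall>j\<in>I. h j \<in> A j" using f g by (auto simp: h_def)
    ultimately show ?thesis by auto
  qed
qed

text \<open>\<open>X\<close> is the edge set of an \<open>m\<close>-regular bipartite multigraph
  with endpoint maps \<open>f\<close> and \<open>g\<close>. Double counting gives Hall's condition:
  the \<open>card J * m\<close> edges at \<open>J\<close> all end in its neighbours, each of which
  meets only \<open>m\<close> edges.\<close>

lemma regular_perfect_matching:
  fixes f g :: "'a \<Rightarrow> nat"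
  assumes X: "finite X" "f ` X \<subseteq> {..<n}" "g ` X \<subseteq> {..<n}" and m: "m > 0"
    and cf: "\<forall>k<n. card {x\<in>X. f x = k} = m" and cg: "\<forall>k<n. card {x\<in>X. g x = k} = m"
  shows "\<exists>M\<subseteq>X. bij_betw f M {..<n} \<and> bij_betw g M {..<n}"
proof -
  define A where "A k = g ` {x\<in>X. f x = k}" for k
  have count: "card {x\<in>X. h x \<in> J} = card J * m"
    if "J \<subseteq> {..<n}" "\<forall>k<n. card {x\<in>X. h x = k} = m" for h :: "'a \<Rightarrow> nat" and J
  proof -
    have "{x\<in>X. h x \<in> J} = (\<Union>k\<in>J. {x\<in>X. h x = k})" by blast
    also have "card \<dots> = (\<Sum>k\<in>J. card {x\<in>X. h x = k})"
      using X that by (intro card_UN_disjoint) (auto intro: finite_subset)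
    also have "\<dots> = (\<Sum>k\<in>J. m)" using that by (intro sum.cong) auto
    finally show ?thesis by simp
  qed
  have "\<exists>s. inj_on s {..<n} \<and> (\<forall>k\<in>{..<n}. s k \<in> A k)"
  proof (rule hall_marriage)
    show "\<forall>k\<in>{..<n}. finite (A k)" using X by (simp add: A_def)
    show "\<forall>J\<subseteq>{..<n}. card J \<le> card (\<Union>(A ` J))"
    proof (intro allI impI)
      fix J :: "nat set" assume J: "J \<subseteq> {..<n}"
      have U: "\<Union>(A ` J) \<subseteq> {..<n}" using X by (auto simp: A_def)
      have "card J * m = card {x\<in>X. f x \<in> J}" using count[OF J cf] by simp
      also have "\<dots> \<le> card {x\<in>X. g x \<in> \<Union>(A ` J)}"
        using X by (intro card_mono) (auto simp: A_def)
      also have "\<dots> = card (\<Union>(A ` J)) * m" by (rule count[OF U cg])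
      finally show "card J \<le> card (\<Union>(A ` J))" using m by simp
    qed
  qed simp
  then obtain s where s: "inj_on s {..<n}" "\<forall>k<n. s k \<in> A k" by auto
  \<comment> \<open>\<open>s\<close> picks neighbours only; edges may be parallel, so an actual edge
    \<open>t k\<close> between \<open>k\<close> and \<open>s k\<close> is chosen next.\<close>
  have "\<exists>x. x \<in> X \<and> f x = k \<and> g x = s k" if "k < n" for k
  proof -
    have "s k \<in> g ` {x\<in>X. f x = k}" using s(2) that by (simp add: A_def)
    then show ?thesis by (smt (verit) imageE mem_Collect_eq)
  qed
  then obtain t where t: "\<And>k. k < n \<Longrightarrow> t k \<in> X \<and> f (t k) = k \<and> g (t k) = s k" by metis
  \<comment> \<open>An injective self-map of a finite set is onto, which makes the matching perfect
    on the \<open>g\<close> side too.\<close>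
  have "s ` {..<n} \<subseteq> {..<n}" using t X by force
  then have "s ` {..<n} = {..<n}" using s by (simp add: endo_inj_surj)
  then have "bij_betw g (t ` {..<n}) {..<n}"
    using t s unfolding bij_betw_def inj_on_def image_image by auto
  moreover have "bij_betw f (t ` {..<n}) {..<n}"
    using t unfolding bij_betw_def inj_on_def image_image by auto
  moreover have "t ` {..<n} \<subseteq> X" using t by auto
  ultimately show ?thesis by blast
qed

text \<open>Koenig's theorem: removing a perfect matching lowers every degree by one, so the edges
  split into \<open>m\<close> matchings, each with its own label.\<close>

lemma regular_edge_colouring:
  fixes f g :: "'a \<Rightarrow> nat"
  assumes "finite X" "f ` X \<subseteq> {..<n}" "g ` X \<subseteq> {..<n}"
    and "\<forall>k<n. card {x\<in>X. f x = k} = m" and "\<forall>k<n. card {x\<in>X. g x = k} = m"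
  shows "\<exists>L :: 'a \<Rightarrow> nat. L ` X \<subseteq> {..<m} \<and> inj_on (\<lambda>x. (f x, L x)) X \<and> inj_on (\<lambda>x. (g x, L x)) X"
  using assms
proof (induction m arbitrary: X)
  case 0
  have "False" if x: "x \<in> X" for x
  proof -
    have "card {y\<in>X. f y = f x} = 0" using 0 x by blast
    then show False using x \<open>finite X\<close> by auto
  qed
  then have "X = {}" by blast
  then show ?case by simp
next
  case (Suc m)
  obtain M where M: "M \<subseteq> X" "bij_betw f M {..<n}" "bij_betw g M {..<n}"
    using regular_perfect_matching[OF Suc.prems(1-3) _ Suc.prems(4,5)] by blast
  \<comment> \<open>The matching contains exactly one edge \<open>y\<close> at vertex
    \<open>k\<close>. The generic \<open>h\<close> serves both endpoint maps.\<close>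
  have less: "card {x\<in>X - M. h x = k} = m"
    if h: "bij_betw h M {..<n}" "\<forall>k<n. card {x\<in>X. h x = k} = Suc m" and k: "k < n"
    for h :: "'a \<Rightarrow> nat" and k
  proof -
    have "k \<in> h ` M" using h(1) k by (simp add: bij_betw_def)
    then obtain y where y: "y \<in> M" "h y = k" by blast
    have "inj_on h M" using h(1) by (rule bij_betw_imp_inj_on)
    then have "{x\<in>X - M. h x = k} = {x\<in>X. h x = k} - {y}"
      using y by (auto dest: inj_onD)
    moreover have "y \<in> {x\<in>X. h x = k}" using y M(1) by blast
    ultimately show ?thesis using h(2) k by simp
  qed
  have "\<exists>L :: 'a \<Rightarrow> nat. L ` (X - M) \<subseteq> {..<m} \<and> inj_on (\<lambda>x. (f x, L x)) (X - M)
      \<and> inj_on (\<lambda>x. (g x, L x)) (X - M)"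
    using Suc.prems less[OF M(2)] less[OF M(3)] by (intro Suc.IH) auto
  then obtain L :: "'a \<Rightarrow> nat" where L: "\<And>x. x \<in> X - M \<Longrightarrow> L x < m"
    "inj_on (\<lambda>x. (f x, L x)) (X - M)" "inj_on (\<lambda>x. (g x, L x)) (X - M)" by blast
  define L' where "L' x = (if x \<in> M then m else L x)" for x
  \<comment> \<open>Labels outside \<open>M\<close> are below \<open>m\<close>, so edges with equal
    labels are both in \<open>M\<close> or both outside. There the matching or the inductive
    labelling separates edges at a common vertex.\<close>
  have inj: "inj_on (\<lambda>x. (h x, L' x)) X"
    if "inj_on (\<lambda>x. (h x, L x)) (X - M)" "inj_on h M" for h :: "'a \<Rightarrow> nat"
  proof (rule inj_onI)
    fix x y assume xy: "x \<in> X" "y \<in> X" "(h x, L' x) = (h y, L' y)"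
    then have "x \<in> M \<longleftrightarrow> y \<in> M"
      using L(1)[of x] L(1)[of y] by (auto simp: L'_def split: if_splits)
    with xy show "x = y"
      using that by (cases "x \<in> M") (auto simp: L'_def inj_on_def)
  qed
  have "L' ` X \<subseteq> {..<Suc m}" using L(1) by (auto simp: L'_def less_SucI)
  then show ?case
    using inj[OF L(2) bij_betw_imp_inj_on[OF M(2)]] inj[OF L(3) bij_betw_imp_inj_on[OF M(3)]]
    by blast
qed

section \<open>Padding, regrouping and inverting compositions\<close>

lemma compositions_SucI:
  "s \<in> S \<Longrightarrow> \<tau> \<in> compositions S m \<Longrightarrow> s \<circ> \<tau> \<in> compositions S (Suc m)"
  by auto

lemma compositions_SucE:
  assumes "\<sigma> \<in> compositions S (Suc m)"
  obtains s \<tau> where "s \<in> S" "\<tau> \<in> compositions S m" "\<sigma> = s \<circ> \<tau>"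
  using assms by auto

lemma compositions_comp:
  "\<sigma> \<in> compositions S a \<Longrightarrow> \<tau> \<in> compositions S b \<Longrightarrow> \<sigma> \<circ> \<tau> \<in> compositions S (a + b)"
proof (induction a arbitrary: \<sigma>)
  case (Suc a)
  obtain s \<sigma>' where s: "s \<in> S" "\<sigma>' \<in> compositions S a" "\<sigma> = s \<circ> \<sigma>'"
    using Suc.prems(1) by (rule compositions_SucE)
  have "s \<circ> (\<sigma>' \<circ> \<tau>) \<in> compositions S (Suc (a + b))"
    by (intro compositions_SucI Suc.IH s Suc.prems)
  then show ?case unfolding s(3) add_Suc comp_assoc .
qed simp

text \<open>Shorter compositions are padded with the identity. In the lower bound this lets
  compositions of one fixed length stand for all shorter ones.\<close>

lemma compositions_mono:
  assumes "id \<in> S" "a \<le> b"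
  shows "compositions S a \<subseteq> compositions S b"
proof
  have id: "id \<in> compositions S c" for c
  proof (induction c)
    case (Suc c)
    then show ?case using compositions_SucI[OF assms(1), of id] by (metis comp_id)
  qed (simp add: id_def)
  fix \<sigma> assume "\<sigma> \<in> compositions S a"
  then have "\<sigma> \<circ> id \<in> compositions S (a + (b - a))" by (rule compositions_comp[OF _ id])
  then show "\<sigma> \<in> compositions S b" using assms(2) by simp
qed

text \<open>Both shuffle types are such products, with the two factors exchanged; the
  \<open>B\<close> move acts first.\<close>

definition products :: "('a \<Rightarrow> 'a) set \<Rightarrow> ('a \<Rightarrow> 'a) set \<Rightarrow> ('a \<Rightarrow> 'a) set" where
  "products A B = {f \<circ> g | f g. f \<in> A \<and> g \<in> B}"

text \<open>Shifting the brackets turns \<open>(a1 b1)(a2 b2)...(am bm)\<close> into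
  \<open>a1 (b1 a2)...(b(m-1) am) bm\<close>; completing both ends with \<open>id\<close> costs one
  extra product.\<close>

lemma compositions_products_swap:
  assumes "id \<in> A" "id \<in> B"
  shows "compositions (products A B) m \<subseteq> compositions (products B A) (Suc m)"
proof
  \<comment> \<open>The leading \<open>A\<close> factor is kept outside, so that the induction can
    absorb it into the next product.\<close>
  have *: "\<exists>a\<in>A. \<exists>\<tau>\<in>compositions (products B A) m. \<sigma> = a \<circ> \<tau>"
    if "\<sigma> \<in> compositions (products A B) m" for \<sigma>
    using that
  proof (induction m arbitrary: \<sigma>)
    case 0
    then show ?case using assms by (intro bexI[of _ id]) auto
  next
    case (Suc m)
    then obtain a b \<tau> where ab: "a \<in> A" "b \<in> B" "\<tau> \<in> compositions (products A B) m"
      "\<sigma> = (a \<circ> b) \<circ> \<tau>"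
      by (auto simp: products_def)
    then obtain a' \<tau>' where \<tau>': "a' \<in> A" "\<tau>' \<in> compositions (products B A) m" "\<tau> = a' \<circ> \<tau>'"
      using Suc.IH by blast
    have "(b \<circ> a') \<circ> \<tau>' \<in> compositions (products B A) (Suc m)"
      using ab \<tau>' by (auto simp: products_def)
    moreover have "\<sigma> = a \<circ> ((b \<circ> a') \<circ> \<tau>')" using ab \<tau>' by (simp add: o_assoc)
    ultimately show ?case using ab by blast
  qed
  fix \<sigma> assume "\<sigma> \<in> compositions (products A B) m"
  then obtain a \<tau> where a: "a \<in> A" "\<tau> \<in> compositions (products B A) m" "\<sigma> = a \<circ> \<tau>"
    using * by blast
  moreover have "id \<circ> a \<in> products B A" using a assms unfolding products_def by blast
  ultimately show "\<sigma> \<in> compositions (products B A) (Suc m)" by auto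
qed

text \<open>Inversion reverses the order of the factors, so a route traversed backwards uses equally
  many shuffles of the other type.\<close>

lemma inv_compositions_products:
  assumes bij: "\<And>f. f \<in> A \<union> B \<Longrightarrow> bij f"
    and inv: "\<And>f. f \<in> A \<Longrightarrow> inv f \<in> A" "\<And>f. f \<in> B \<Longrightarrow> inv f \<in> B"
    and \<sigma>: "\<sigma> \<in> compositions (products A B) m"
  shows "bij \<sigma> \<and> inv \<sigma> \<in> compositions (products B A) m"
  using \<sigma>
proof (induction m arbitrary: \<sigma>)
  case 0
  then have "\<sigma> = id" by simp
  then show ?case by (metis bij_id compositions.simps(1) inv_id singletonI)
next
  case (Suc m)
  then obtain a b \<tau> where ab: "a \<in> A" "b \<in> B" "\<tau> \<in> compositions (products A B) m"
    "\<sigma> = (a \<circ> b) \<circ> \<tau>"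
    by (auto simp: products_def)
  note \<tau> = Suc.IH[OF ab(3)]
  have bab: "bij (a \<circ> b)" using ab bij by (blast intro: bij_comp)
  have "inv (a \<circ> b) = inv b \<circ> inv a" using ab bij by (simp add: o_inv_distrib)
  then have "inv (a \<circ> b) \<in> products B A" using ab inv by (auto simp: products_def)
  \<comment> \<open>The inverted shuffle goes on the right, whereas \<open>compositions\<close>
    grows on the left; it is therefore treated as a composition of length one.\<close>
  then have "inv (a \<circ> b) \<circ> id \<in> compositions (products B A) 1"
    by (auto simp del: o_id comp_id)
  then have "inv \<tau> \<circ> inv (a \<circ> b) \<in> compositions (products B A) (m + 1)"
    using \<tau> compositions_comp by (metis comp_id)
  then show ?case
    unfolding ab(4) using bab \<tau> by (metis Suc_eq_plus1 bij_comp o_inv_distrib)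
qed

section \<open>Horizontal and vertical moves as families closed under inverses\<close>

lemma VH_shuffles_products: "VH_shuffles n = products (range (H_move n)) (range (V_move n))"
  unfolding VH_shuffles_def products_def by blast

lemma HV_shuffles_products: "HV_shuffles n = products (range (V_move n)) (range (H_move n))"
  unfolding HV_shuffles_def products_def by blast

lemma id_in_H_moves: "id \<in> range (H_move n)"
proof -
  have "H_move n (\<lambda>_. 0) = id" by (auto simp: H_move_def positions_def fun_eq_iff)
  then show ?thesis by (metis rangeI)
qed

lemma id_in_V_moves: "id \<in> range (V_move n)"
proof -
  have "V_move n (\<lambda>_. 0) = id" by (auto simp: V_move_def positions_def fun_eq_iff)
  then show ?thesis by (metis rangeI)
qed

lemma inv_H_move: "inv (H_move n a) = H_move n (\<lambda>r. - a r)"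
proof -
  have "H_move n (\<lambda>r. - b r) (H_move n b p) = p" for b p
    by (cases p) (auto simp: H_move_def positions_def mod_simps nat_less_iff)
  from this[of a] this[of "\<lambda>r. - a r"] show ?thesis by (intro inv_equality) auto
qed

lemma inv_V_move: "inv (V_move n b) = V_move n (\<lambda>k. - b k)"
proof -
  have "V_move n (\<lambda>k. - a k) (V_move n a p) = p" for a p
    by (cases p) (auto simp: V_move_def positions_def mod_simps nat_less_iff)
  from this[of b] this[of "\<lambda>k. - b k"] show ?thesis by (intro inv_equality) auto
qed

section \<open>Conveying cells to prescribed columns\<close>

text \<open>One step of the conveyor belt: the V-move brings row \<open>w k\<close> of column
  \<open>k\<close> to row 0, and the H-move rotates row 0 alone, so only one chosen cell per column
  is conveyed.\<close>

lemma window_shuffle: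
  assumes "k < n" "r < n" "w k < n"
  shows "fst ((H_move n (\<lambda>r. if r = 0 then int m else 0) \<circ> V_move n (\<lambda>k. - int (w k))) (k, r))
    = (if r = w k then (k + m) mod n else k)"
proof (cases "r = w k")
  case True
  then show ?thesis
    using assms by (simp add: V_move_def H_move_def positions_def flip: of_nat_add zmod_int)
next
  case False
  have "(int r - int (w k)) mod int n \<noteq> 0"
  proof
    assume "(int r - int (w k)) mod int n = 0"
    then have "int r mod int n = int (w k) mod int n" by (simp add: mod_eq_dvd_iff dvd_eq_mod_eq_0)
    then show False using assms False by simp
  qed
  moreover have "0 \<le> (int r - int (w k)) mod int n" using assms by simp
  ultimately have "nat ((int r - int (w k)) mod int n) \<noteq> 0" by linarith
  then show ?thesis
    using assms False by (simp add: V_move_def H_move_def positions_def nat_less_iff)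
qed

text \<open>The labels in a column form a permutation, so each displacement modulo \<open>n\<close>
  occurs there once, and one shuffle per displacement suffices. Rows are left uncontrolled, hence
  only \<open>fst\<close> is prescribed.\<close>

lemma send_to_columns:
  assumes L: "\<And>p. p \<in> positions n \<Longrightarrow> L p < n"
    and inj: "\<And>k. k < n \<Longrightarrow> inj_on (\<lambda>r. L (k, r)) {..<n}"
  shows "\<exists>\<sigma>\<in>compositions (VH_shuffles n) n. \<forall>p\<in>positions n. fst (\<sigma> p) = L p"
proof -
  \<comment> \<open>Adding \<open>n\<close> keeps the natural subtraction from truncating, as
    \<open>fst p < n\<close>.\<close>
  define \<delta> where "\<delta> p = (L p + n - fst p) mod n" for p
  have \<delta>: "(fst p + \<delta> p) mod n = L p" "\<delta> p < n" if p: "p \<in> positions n" for p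
  proof -
    have "fst p < n" using p by (auto simp: positions_def)
    then have "(fst p + \<delta> p) mod n = (fst p + (L p + n - fst p)) mod n"
      by (simp add: \<delta>_def mod_simps)
    then show "(fst p + \<delta> p) mod n = L p" using L[OF p] \<open>fst p < n\<close> by simp
    show "\<delta> p < n" using \<open>fst p < n\<close> by (simp add: \<delta>_def)
  qed
  \<comment> \<open>Shuffle number m brings the cell of displacement m in each column to row 0 and rotates
    row 0 by m. Each cell leaves its column exactly once, since a cell that has arrived is not
    selected again.\<close>
  have "\<exists>\<sigma>\<in>compositions (VH_shuffles n) m.
      \<forall>p\<in>positions n. fst (\<sigma> p) = (if \<delta> p < m then L p else fst p)" if "m \<le> n" for m
    using that
  proof (induction m)
    case 0
    then show ?case by simp
  next
    case (Suc m)
    then obtain \<sigma> where \<sigma>: "\<sigma> \<in> compositions (VH_shuffles n) m"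
      and fst_\<sigma>: "\<And>p. p \<in> positions n \<Longrightarrow> fst (\<sigma> p) = (if \<delta> p < m then L p else fst p)"
      by auto
    have perm: "\<sigma> permutes positions n" using \<sigma> compositions_permutes by blast
    have "\<exists>r<n. L (k, r) = (k + m) mod n" if "k < n" for k
    proof -
      have "(\<lambda>r. L (k, r)) ` {..<n} \<subseteq> {..<n}" using L that by (auto simp: positions_def)
      then have "(\<lambda>r. L (k, r)) ` {..<n} = {..<n}"
        using inj[OF that] by (simp add: endo_inj_surj)
      moreover have "(k + m) mod n \<in> {..<n}" using that by simp
      ultimately show ?thesis by (metis (no_types, lifting) imageE lessThan_iff)
    qed
    then obtain \<rho> where \<rho>: "\<And>k. k < n \<Longrightarrow> \<rho> k < n \<and> L (k, \<rho> k) = (k + m) mod n" by metis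
    have \<delta>\<rho>: "\<delta> (k, \<rho> k) = m" if "k < n" for k
    proof -
      have "\<delta> (k, \<rho> k) = ((k + m) mod n + n - k) mod n" using \<rho>[OF that] by (simp add: \<delta>_def)
      also have "\<dots> = m"
        using that \<open>Suc m \<le> n\<close> by (cases "k + m < n") (auto simp: le_mod_geq)
      finally show ?thesis .
    qed
    \<comment> \<open>The current row of the selected cell, which is still in column
      \<open>k\<close> because its displacement is not below \<open>m\<close>.\<close>
    define w where "w k = snd (\<sigma> (k, \<rho> k))" for k
    have w: "\<sigma> (k, \<rho> k) = (k, w k)" "w k < n" if "k < n" for k
    proof -
      have p: "(k, \<rho> k) \<in> positions n" using \<rho> that by (auto simp: positions_def)
      show *: "\<sigma> (k, \<rho> k) = (k, w k)"
        using fst_\<sigma>[OF p] \<delta>\<rho>[OF that] by (simp add: w_def prod_eq_iff)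
      show "w k < n" using permutes_in_image[OF perm, of "(k, \<rho> k)"] p
        unfolding * by (simp add: positions_def)
    qed
    define s where "s = H_move n (\<lambda>r. if r = 0 then int m else 0) \<circ> V_move n (\<lambda>k. - int (w k))"
    have "fst ((s \<circ> \<sigma>) p) = (if \<delta> p < Suc m then L p else fst p)" if p: "p \<in> positions n" for p
    proof -
      obtain k r where kr: "\<sigma> p = (k, r)" by fastforce
      have *: "k < n" "r < n"
        using permutes_in_image[OF perm, of p] p kr by (auto simp: positions_def)
      have s: "fst ((s \<circ> \<sigma>) p) = (if r = w k then (k + m) mod n else k)"
        using window_shuffle[where w = w, OF * w(2)[OF *(1)], of m] by (simp add: s_def kr)
      show ?thesis
      proof (cases "\<delta> p = m")
        case True
        then have k: "k = fst p" using fst_\<sigma>[OF p] kr by simp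
        have p_eq: "p = (k, snd p)" using k by simp
        have Lp: "L p = (k + m) mod n" using \<delta>(1)[OF p] True k by simp
        then have "L (k, snd p) = L (k, \<rho> k)" using \<rho>[OF *(1)] p_eq by metis
        moreover have "snd p < n" using p by (auto simp: positions_def)
        ultimately have "snd p = \<rho> k"
          using inj_onD[OF inj[OF *(1)], of "snd p" "\<rho> k"] \<rho>[OF *(1)] by simp
        then have "p = (k, \<rho> k)" using k by (simp add: prod_eq_iff)
        then have "r = w k" using kr by (simp add: w_def)
        then show ?thesis using s Lp True by simp
      next
        case False
        \<comment> \<open>By injectivity of \<open>\<sigma>\<close>, position
          \<open>(k, w k)\<close> holds only the cell from \<open>(k, \<rho> k)\<close>, whose
          displacement is \<open>m\<close>.\<close>
        have "r \<noteq> w k"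
        proof
          assume "r = w k"
          then have "\<sigma> p = \<sigma> (k, \<rho> k)" using kr w *(1) by simp
          then have "p = (k, \<rho> k)" using permutes_inj[OF perm] by (simp add: inj_eq)
          then show False using False \<delta>\<rho> *(1) by simp
        qed
        then show ?thesis using s False fst_\<sigma>[OF p] kr by auto
      qed
    qed
    moreover have "s \<circ> \<sigma> \<in> compositions (VH_shuffles n) (Suc m)"
      using \<sigma> by (intro compositions_SucI) (auto simp: s_def VH_shuffles_def)
    ultimately show ?case by blast
  qed
  from this[of n] \<delta>(2) show ?thesis by auto
qed

section \<open>Upper bound through a common square\<close>

lemma push_comp: "bij \<sigma> \<Longrightarrow> bij \<tau> \<Longrightarrow> push (\<sigma> \<circ> \<tau>) P = push \<sigma> (push \<tau> P)"
  by (simp add: push_def o_inv_distrib o_assoc)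

lemma equi_squares_less: "P \<in> equi_squares n \<Longrightarrow> p \<in> positions n \<Longrightarrow> P p < n"
  using PiE_mem unfolding equi_squares_def by fastforce

lemma equi_square_to_columns:
  assumes P: "P \<in> equi_squares n"
  shows "\<exists>\<sigma>\<in>compositions (VH_shuffles n) (2 * n). push \<sigma> P = restrict fst (positions n)"
proof -
  note P_less = equi_squares_less[OF P]
  have "{p \<in> positions n. fst p = k} = {k} \<times> {0..<n}" if "k < n" for k
    using that by (auto simp: positions_def)
  then have card_fst: "\<forall>k<n. card {p \<in> positions n. fst p = k} = n"
    by (simp add: card_cartesian_product)
  \<comment> \<open>Cells are edges joining their column to their colour: columns have degree
    \<open>n\<close> by the shape of the square, colours by the equi-square condition.\<close>
  have "\<exists>L :: nat \<times> nat \<Rightarrow> nat. L ` positions n \<subseteq> {..<n}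
      \<and> inj_on (\<lambda>p. (fst p, L p)) (positions n) \<and> inj_on (\<lambda>p. (P p, L p)) (positions n)"
  proof (rule regular_edge_colouring)
    show "\<forall>k<n. card {p \<in> positions n. P p = k} = n"
      using P by (auto simp: equi_squares_def)
  qed (use finite_positions P_less card_fst in \<open>auto simp: positions_def\<close>)
  then obtain L :: "nat \<times> nat \<Rightarrow> nat" where L: "L ` positions n \<subseteq> {..<n}"
    "inj_on (\<lambda>p. (fst p, L p)) (positions n)" "inj_on (\<lambda>p. (P p, L p)) (positions n)"
    by blast
  have "inj_on (\<lambda>r. L (k, r)) {..<n}" if "k < n" for k
  proof (rule inj_onI)
    fix r r' assume "r \<in> {..<n}" "r' \<in> {..<n}" "L (k, r) = L (k, r')"
    with inj_onD[OF L(2), of "(k, r)" "(k, r')"] that show "r = r'"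
      by (simp add: positions_def)
  qed
  then obtain \<sigma> where \<sigma>: "\<sigma> \<in> compositions (VH_shuffles n) n"
    "\<And>p. p \<in> positions n \<Longrightarrow> fst (\<sigma> p) = L p"
    using send_to_columns[of n L] L(1) by blast
  have perm: "\<sigma> permutes positions n" using \<sigma>(1) compositions_permutes by blast
  define P' where "P' = push \<sigma> P"
  have P': "P' \<in> equi_squares n" using push_equi_squares[OF perm P] by (simp add: P'_def)
  \<comment> \<open>Cells now in column \<open>k\<close> share the label \<open>k\<close>, and cells
    sharing a label have distinct colours. So the colours of \<open>P'\<close> can serve as labels
    for a second conveyance.\<close>
  have "inj_on (\<lambda>r. P' (k, r)) {..<n}" if k: "k < n" for k
  proof (rule inj_onI)
    fix r r' assume r: "r \<in> {..<n}" "r' \<in> {..<n}" and eq: "P' (k, r) = P' (k, r')"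
    have pos: "(k, r) \<in> positions n" "(k, r') \<in> positions n"
      using r k by (auto simp: positions_def)
    then have "(k, r) \<in> \<sigma> ` positions n" "(k, r') \<in> \<sigma> ` positions n"
      using permutes_image[OF perm] by auto
    then obtain p p' where p: "p \<in> positions n" "\<sigma> p = (k, r)"
      and p': "p' \<in> positions n" "\<sigma> p' = (k, r')"
      by (auto simp: image_iff)
    have "P p = P p'" using eq push_apply[OF perm, of P] p p' by (metis P'_def)
    moreover have "L p = L p'" using \<sigma>(2) p p' by (metis fst_conv)
    ultimately have "p = p'" using L(3) p p' by (auto dest: inj_onD)
    then show "r = r'" using p p' by simp
  qed
  then obtain \<tau> where \<tau>: "\<tau> \<in> compositions (VH_shuffles n) n"
    "\<And>p. p \<in> positions n \<Longrightarrow> fst (\<tau> p) = P' p"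
    using send_to_columns[of n P'] equi_squares_less[OF P'] by blast
  have perm': "\<tau> permutes positions n" using \<tau>(1) compositions_permutes by blast
  have "push \<tau> P' \<in> equi_squares n" by (rule push_equi_squares[OF perm' P'])
  then have ext: "push \<tau> P' \<in> extensional (positions n)"
    by (auto simp: equi_squares_def PiE_def)
  have "push \<tau> P' = restrict fst (positions n)"
  proof (rule extensionalityI[OF ext])
    fix q assume q: "q \<in> positions n"
    then obtain p where p: "p \<in> positions n" "q = \<tau> p"
      using permutes_image[OF perm'] by blast
    then show "push \<tau> P' q = restrict fst (positions n) q"
      using q \<tau>(2)[OF p(1)] push_apply[OF perm', of P' p] by simp
  qed simp
  moreover have "push (\<tau> \<circ> \<sigma>) P = push \<tau> P'"
    unfolding P'_def by (intro push_comp permutes_bij[OF perm] permutes_bij[OF perm'])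
  moreover have "\<tau> \<circ> \<sigma> \<in> compositions (VH_shuffles n) (2 * n)"
    using compositions_comp[OF \<tau>(1) \<sigma>(1)] by (simp add: mult_2)
  ultimately show ?thesis by metis
qed

lemma equi_squares_connected:
  assumes P: "P \<in> equi_squares n" and Q: "Q \<in> equi_squares n"
    and S: "S = HV_shuffles n \<or> S = VH_shuffles n"
  shows "\<exists>\<sigma>\<in>compositions S (4 * n + 1). push \<sigma> P = Q"
proof -
  obtain \<sigma> \<tau> where \<sigma>: "\<sigma> \<in> compositions (VH_shuffles n) (2 * n)"
      "push \<sigma> P = restrict fst (positions n)"
    and \<tau>: "\<tau> \<in> compositions (VH_shuffles n) (2 * n)"
      "push \<tau> Q = restrict fst (positions n)"
    using equi_square_to_columns P Q by metis
  have bij: "bij \<sigma>" "bij \<tau>"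
    using \<sigma>(1) \<tau>(1) compositions_permutes permutes_bij by blast+
  have "inv \<tau> \<in> compositions (HV_shuffles n) (2 * n)"
    unfolding HV_shuffles_products
  proof (rule inv_compositions_products[THEN conjunct2])
    show "\<tau> \<in> compositions (products (range (H_move n)) (range (V_move n))) (2 * n)"
      using \<tau>(1) by (simp only: VH_shuffles_products)
  qed (auto simp: inv_H_move inv_V_move
      intro: permutes_bij[OF H_move_permutes] permutes_bij[OF V_move_permutes])
  moreover have "compositions (HV_shuffles n) m \<subseteq> compositions (VH_shuffles n) (Suc m)"
    "compositions (VH_shuffles n) m \<subseteq> compositions (HV_shuffles n) (Suc m)" for m
    unfolding VH_shuffles_products HV_shuffles_products
    by (intro compositions_products_swap id_in_H_moves id_in_V_moves)+
  \<comment> \<open>For HV-shuffles \<open>\<sigma>\<close> is regrouped, for VH-shuffles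
    \<open>inv \<tau>\<close>; either way only one half pays the extra shuffle.\<close>
  ultimately have "\<exists>a b. a + b = 4 * n + 1 \<and> inv \<tau> \<in> compositions S a \<and> \<sigma> \<in> compositions S b"
    using S \<sigma>(1)
    by (elim disjE) (force intro: exI[of _ "2 * n"] exI[of _ "Suc (2 * n)"] simp del: compositions.simps)+
  then have "inv \<tau> \<circ> \<sigma> \<in> compositions S (4 * n + 1)" using compositions_comp by metis
  moreover have "push (inv \<tau> \<circ> \<sigma>) P = push (inv \<tau> \<circ> \<tau>) Q"
    using bij \<sigma>(2) \<tau>(2) by (simp add: push_comp bij_imp_bij_inv)
  moreover have "push (inv \<tau> \<circ> \<tau>) Q = Q"
    using bij by (simp add: bij_is_inj push_def inv_o_cancel)
  ultimately show ?thesis by metis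
qed

section \<open>Counting shuffles and the lower bound\<close>

text \<open>Only the rotation amounts of the \<open>n\<close> rows matter, and only modulo
  \<open>n\<close>.\<close>

lemma finite_card_H_moves: "finite (range (H_move n)) \<and> card (range (H_move n)) \<le> n ^ n"
proof -
  define F where "F = {..<n} \<rightarrow>\<^sub>E int ` {..<n}"
  have F: "finite F" "card F = n ^ n"
    by (simp_all add: F_def finite_PiE card_PiE card_image)
  have "range (H_move n) \<subseteq> H_move n ` F"
  proof clarify
    fix a
    define a' where "a' = restrict (\<lambda>r. a r mod int n) {..<n}"
    have "a r mod int n \<in> int ` {..<n}" if "r < n" for r
      using that by (intro image_eqI[of _ _ "nat (a r mod int n)"]) (auto simp: nat_less_iff)
    then have "a' \<in> F" by (auto simp: a'_def F_def)
    moreover have "H_move n a = H_move n a'"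
      by (auto simp: H_move_def positions_def a'_def fun_eq_iff mod_simps)
    ultimately show "H_move n a \<in> H_move n ` F" by blast
  qed
  moreover have "finite (H_move n ` F)" "card (H_move n ` F) \<le> n ^ n"
    using F card_image_le[OF F(1), of "H_move n"] by auto
  ultimately show ?thesis
    using card_mono finite_subset order_trans by meson
qed

text \<open>Exchanging the coordinates conjugates V-moves into H-moves.\<close>

lemma finite_card_V_moves: "finite (range (V_move n)) \<and> card (range (V_move n)) \<le> n ^ n"
proof -
  have "V_move n b = prod.swap \<circ> H_move n b \<circ> prod.swap" for b
    by (auto simp: V_move_def H_move_def positions_def fun_eq_iff)
  then have "range (V_move n) = (\<lambda>f. prod.swap \<circ> f \<circ> prod.swap) ` range (H_move n)"
    by auto
  then show ?thesis
    using finite_card_H_moves[of n] by (metis card_image_le finite_imageI order_trans)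
qed

lemma finite_card_products:
  assumes "finite A \<and> card A \<le> a" "finite B \<and> card B \<le> b"
  shows "finite (products A B) \<and> card (products A B) \<le> a * b"
proof -
  have "products A B = (\<lambda>(f, g). f \<circ> g) ` (A \<times> B)" by (auto simp: products_def)
  moreover have "card ((\<lambda>(f, g). f \<circ> g) ` (A \<times> B)) \<le> card A * card B"
    using assms card_image_le[of "A \<times> B" "\<lambda>(f, g). f \<circ> g"] by (simp add: card_cartesian_product)
  moreover have "card A * card B \<le> a * b" using assms by (simp add: mult_le_mono)
  ultimately show ?thesis using assms by auto
qed

lemma finite_card_compositions:
  assumes "finite S \<and> card S \<le> c"
  shows "finite (compositions S m) \<and> card (compositions S m) \<le> c ^ m"
proof (induction m)
  case (Suc m)
  have "compositions S (Suc m) = products S (compositions S m)" by (auto simp: products_def)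
  then show ?case using finite_card_products[OF assms Suc] by simp
qed simp

lemma far_away_equi_square:
  assumes n: "n \<ge> 2" and S: "S = HV_shuffles n \<or> S = VH_shuffles n" and P: "P \<in> equi_squares n"
  shows "\<exists>Q\<in>equi_squares n. Q \<noteq> P \<and>
    at_least_away S (log 2 (real (card (equi_squares n))) / (2 * real n * log 2 (real n))) P Q"
proof -
  define s where "s = card (equi_squares n)"
  define x where "x = log 2 (real s) / (2 * real n * log 2 (real n))"
  have fin: "finite (equi_squares n)"
    by (rule finite_subset[of _ "positions n \<rightarrow>\<^sub>E {0..<n}"])
      (auto simp: equi_squares_def finite_positions intro: finite_PiE)
  \<comment> \<open>Swapping a cell of colour 0 with one of colour 1 gives another square; thus
    \<open>s \<ge> 2\<close>, which makes \<open>x\<close> positive.\<close>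
  have "\<exists>P'\<in>equi_squares n. P' \<noteq> P"
  proof -
    have "\<exists>p\<in>positions n. P p = c" if "c < n" for c
    proof -
      have "card {p \<in> positions n. P p = c} = n" using P that by (auto simp: equi_squares_def)
      then have "{p \<in> positions n. P p = c} \<noteq> {}" using n by (metis card.empty not_numeral_le_zero)
      then show ?thesis by blast
    qed
    from this[of 0] this[of 1] n obtain p q
      where pq: "p \<in> positions n" "q \<in> positions n" "P p = 0" "P q = 1" by auto
    define \<pi> where "\<pi> = transpose p q"
    have \<pi>: "\<pi> permutes positions n" using pq by (simp add: \<pi>_def permutes_swap_id)
    have "push \<pi> P q = 0" using push_apply[OF \<pi>, of P p] pq by (simp add: \<pi>_def)
    then have "push \<pi> P \<noteq> P" using pq by auto
    then show ?thesis using push_equi_squares[OF \<pi> P] by blast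
  qed
  then have "s \<ge> 2"
    using P fin unfolding s_def by (metis One_nat_def Suc_1 card_le_Suc0_iff_eq not_less_eq_eq)
  then have x: "x > 0" using n by (simp add: x_def)
  \<comment> \<open>The largest natural number strictly below \<open>x\<close>; \<open>nat\<close>
    does not truncate, since \<open>x > 0\<close>.\<close>
  define K where "K = nat (\<lceil>x\<rceil> - 1)"
  have K: "real K < x" "\<And>k. real k < x \<Longrightarrow> k \<le> K"
    using x unfolding K_def by linarith+
  have S': "finite S \<and> card S \<le> n ^ (2 * n)"
    using S finite_card_products[OF finite_card_H_moves[of n] finite_card_V_moves[of n]]
      finite_card_products[OF finite_card_V_moves[of n] finite_card_H_moves[of n]]
    unfolding VH_shuffles_products HV_shuffles_products mult_2 power_add by auto
  have "id \<circ> id \<in> S"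
    using S id_in_H_moves id_in_V_moves
    unfolding VH_shuffles_products HV_shuffles_products products_def by blast
  then have id: "id \<in> S" by simp
  \<comment> \<open>Because \<open>id\<close> is a shuffle, \<open>R\<close> contains every square
    reachable with at most \<open>K\<close> shuffles, in particular \<open>P\<close> itself.\<close>
  define R where "R = (\<lambda>\<sigma>. push \<sigma> P) ` compositions S K"
  have comps: "finite (compositions S K)" "card (compositions S K) \<le> (n ^ (2 * n)) ^ K"
    using finite_card_compositions S' by blast+
  have "card R \<le> n ^ (2 * n * K)"
    unfolding R_def using card_image_le[OF comps(1)] comps(2) by (metis order_trans power_mult)
  moreover have "n ^ (2 * n * K) < s"
  proof -
    have "log 2 (real (n ^ (2 * n * K))) = real K * (2 * real n * log 2 (real n))"
      using n by (simp add: log_nat_power)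
    also have "\<dots> < log 2 (real s)"
      using K(1) n by (simp add: x_def pos_less_divide_eq)
    finally show ?thesis using n \<open>s \<ge> 2\<close> by (simp del: of_nat_power)
  qed
  ultimately have "card R < card (equi_squares n)" by (simp add: s_def)
  then have "\<not> equi_squares n \<subseteq> R"
    using card_mono[of R "equi_squares n"] comps(1) by (auto simp: R_def)
  then obtain Q where Q: "Q \<in> equi_squares n" "Q \<notin> R" by blast
  have "push id P \<in> R"
    using compositions_mono[OF id, of 0 K] by (auto simp: R_def)
  then have "Q \<noteq> P" using Q by (auto simp: push_def)
  moreover have "at_least_away S x P Q"
    unfolding at_least_away_def
  proof (intro allI ballI impI)
    fix k \<sigma> assume \<sigma>: "\<sigma> \<in> compositions S k" "push \<sigma> P = Q"
    then have "\<not> k \<le> K" using compositions_mono[OF id, of k K] Q(2) by (auto simp: R_def)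
    then show "x \<le> real k" using K(2)[of k] by linarith
  qed
  ultimately show ?thesis using Q(1) by (auto simp: x_def s_def)
qed

theorem theoremA:
  fixes n :: nat and S :: "(nat \<times> nat \<Rightarrow> nat \<times> nat) set"
  assumes "n \<ge> 2" and "S = HV_shuffles n \<or> S = VH_shuffles n"
  shows "(\<forall>P\<in>equi_squares n. \<forall>\<pi>. \<pi> permutes positions n \<longrightarrow>
            (\<exists>m. \<exists>\<sigma>\<in>compositions S m. push \<sigma> P = push \<pi> P))
       \<and> (\<forall>P\<in>equi_squares n. \<exists>Q\<in>equi_squares n. Q \<noteq> P \<and>
            at_least_away S (log 2 (real (card (equi_squares n))) / (2 * real n * log 2 (real n))) P Q)
       \<and> (n \<le> 34 \<or> n = 37 \<longrightarrow>
            (\<forall>P\<in>equi_squares n. \<forall>Q\<in>equi_squares n.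
               at_most_away S (if even n then 6 * n - 3 else 6 * n + 3) P Q))"
proof (intro conjI ballI allI impI)
  fix P \<pi> assume "P \<in> equi_squares n" "\<pi> permutes positions n"
  \<comment> \<open>Only the resulting colours must agree, and \<open>push \<pi> P\<close> is again
    an equi-square, so connectedness suffices.\<close>
  then show "\<exists>m. \<exists>\<sigma>\<in>compositions S m. push \<sigma> P = push \<pi> P"
    using equi_squares_connected[OF _ push_equi_squares assms(2)] by blast
next
  fix P assume "P \<in> equi_squares n"
  then show "\<exists>Q\<in>equi_squares n. Q \<noteq> P \<and>
      at_least_away S (log 2 (real (card (equi_squares n))) / (2 * real n * log 2 (real n))) P Q"
    by (rule far_away_equi_square[OF assms])
next
  fix P Q assume "P \<in> equi_squares n" "Q \<in> equi_squares n"
  then have "\<exists>\<sigma>\<in>compositions S (4 * n + 1). push \<sigma> P = Q"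
    using assms(2) by (rule equi_squares_connected)
  \<comment> \<open>The even case amounts to \<open>4 \<le> 2 * n\<close>, with equality at
    \<open>n = 2\<close>.\<close>
  moreover have "4 * n + 1 \<le> (if even n then 6 * n - 3 else 6 * n + 3)"
    using assms(1) by (simp, arith)
  ultimately show "at_most_away S (if even n then 6 * n - 3 else 6 * n + 3) P Q"
    unfolding at_most_away_def by blast
qed

end
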